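(* Let $n$ be a positive integer, let $k\geq 2$ be an integer, and let $f,f':V(C_n)\to\{1,\ldots,k\}$ be $k$-color weak maximizers of $W$ on $C_n$. Write $\mathrm{type}(f)=(n_1,\ldots,n_k)$ (so $n_1\leq\cdots\leq n_k$), and suppose that $j,j'\in\{1,\ldots,k\}$ with $j<j'$ are such that $\mathrm{type}(f')=R_{j,j'}(\mathrm{type}(f))$. (1) If $n$ is even and $n_j=n_{j'}=2a$ for some positive integer $a$, then $W(f)=W(f')$. (2) Otherwise, $W(f)<W(f')$.
   Context: $C_n$ is the cycle on $n$ vertices (vertices $0,\ldots,n-1$, with distinct vertices $i,j$ adjacent iff $i-j\equiv\pm1\pmod n$). For a finite simple connected graph $G$ and $A\subseteq V(G)$, $W(A)=\sum_{\{u,v\}\in\binom{A}{2}}d_G(u,v)$, with $d_G$ the shortest-path distance. A $k$-coloring of $G$ is any function $f:V(G)\to\{1,\ldots,k\}$; $\mathrm{type}(f)$ is the $k$-tuple of the cardinalities $|f^{-1}(1)|,\ldots,|f^{-1}(k)|$ arranged in non-decreasing order, and $W(f)=\sum_{i=1}^k W(f^{-1}(i))$. For $k\geq 2$, $f$ is a $k$-color weak maximizer of $W$ on $G$ if $f$ is surjective and $W(f)\geq W(f')$ for all surjective $f':V(G)\to\{1,\ldots,k\}$ with $\mathrm{type}(f')=\mathrm{type}(f)$. For $1\leq j<j'\leq k$ and a non-decreasing $k$-tuple of integers $x=(x_1,\ldots,x_k)$, $R_{j,j'}(x)$ (the reverse Robin Hood transfer from $j$ to $j'$) is the tuple obtained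 from $x$ by subtracting $1$ from the $j$th entry, adding $1$ to the $j'$th entry, and then rearranging the result in non-decreasing order. *)

theory Defs
  imports Main "HOL-Number_Theory.Cong"
begin

text \<open>A simple graph is given by its vertex set \<open>V\<close> and its symmetric, irreflexive
  adjacency relation \<open>adj\<close>.\<close>

definition is_path :: "'a set \<Rightarrow> ('a \<Rightarrow> 'a \<Rightarrow> bool) \<Rightarrow> 'a \<Rightarrow> 'a list \<Rightarrow> 'a \<Rightarrow> bool" where
  "is_path V adj u p v \<longleftrightarrow>
     p \<noteq> [] \<and> hd p = u \<and> last p = v \<and> set p \<subseteq> V \<and> distinct p \<and> successively adj p"

text \<open>The length of a path is its number of edges, one less than its number of vertices.
  The distance is only meaningful for vertices in the same component.\<close>

definition graph_dist :: "'a set \<Rightarrow> ('a \<Rightarrow> 'a \<Rightarrow> bool) \<Rightarrow> 'a \<Rightarrow> 'a \<Rightarrow> nat" where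
  "graph_dist V adj u v = (LEAST l. \<exists>p. is_path V adj u p v \<and> length p = Suc l)"

text \<open>Each unordered pair of distinct vertices is represented by its increasing
  enumeration, so that it is counted exactly once.\<close>

definition wiener :: "'a::linorder set \<Rightarrow> ('a \<Rightarrow> 'a \<Rightarrow> bool) \<Rightarrow> 'a set \<Rightarrow> nat" where
  "wiener V adj A = (\<Sum>(u, v) \<in> {(u, v). u \<in> A \<and> v \<in> A \<and> u < v}. graph_dist V adj u v)"

text \<open>Colorings are total functions, of which only the values on \<open>V\<close> matter.\<close>

definition color_class :: "'a set \<Rightarrow> ('a \<Rightarrow> nat) \<Rightarrow> nat \<Rightarrow> 'a set" where
  "color_class V f i = {v \<in> V. f v = i}"

definition surj_coloring :: "'a set \<Rightarrow> nat \<Rightarrow> ('a \<Rightarrow> nat) \<Rightarrow> bool" where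
  "surj_coloring V k f \<longleftrightarrow> f ` V = {1..k}"

definition wiener_coloring ::
    "'a::linorder set \<Rightarrow> ('a \<Rightarrow> 'a \<Rightarrow> bool) \<Rightarrow> nat \<Rightarrow> ('a \<Rightarrow> nat) \<Rightarrow> nat" where
  "wiener_coloring V adj k f = (\<Sum>i = 1..k. wiener V adj (color_class V f i))"

text \<open>Tuples are lists; the entry with (1-based) index \<open>j\<close> of the tuple \<open>x\<close> is \<open>x ! (j - 1)\<close>.
  Entries are integers because a transfer may lead to a negative entry.\<close>

definition coloring_type :: "'a set \<Rightarrow> nat \<Rightarrow> ('a \<Rightarrow> nat) \<Rightarrow> int list" where
  "coloring_type V k f = sort (map (\<lambda>i. int (card (color_class V f i))) [1..<Suc k])"

definition reverse_robin_hood :: "nat \<Rightarrow> nat \<Rightarrow> int list \<Rightarrow> int list" where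
  "reverse_robin_hood j j' x =
     sort (x[j - 1 := x ! (j - 1) - 1, j' - 1 := x ! (j' - 1) + 1])"

definition weak_maximizer ::
    "'a::linorder set \<Rightarrow> ('a \<Rightarrow> 'a \<Rightarrow> bool) \<Rightarrow> nat \<Rightarrow> ('a \<Rightarrow> nat) \<Rightarrow> bool" where
  "weak_maximizer V adj k f \<longleftrightarrow>
     surj_coloring V k f \<and>
     (\<forall>g. surj_coloring V k g \<and> coloring_type V k g = coloring_type V k f \<longrightarrow>
        wiener_coloring V adj k g \<le> wiener_coloring V adj k f)"

definition cycle_verts :: "nat \<Rightarrow> nat set" where
  "cycle_verts n = {0..<n}"

definition cycle_adj :: "nat \<Rightarrow> nat \<Rightarrow> nat \<Rightarrow> bool" where
  "cycle_adj n i j \<longleftrightarrow>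
     i \<noteq> j \<and> ([int i - int j = 1] (mod int n) \<or> [int i - int j = - 1] (mod int n))"

end

theory Submission
  imports Defs
begin

text \<open>
  The Wiener index of a vertex set of a cycle is governed by half-length arcs. Put
  \<open>h = n div 2\<close>. Of the \<open>n\<close> arcs of \<open>h\<close> consecutive vertices, exactly \<open>d(u, v)\<close> contain \<open>u\<close>
  but not \<open>v\<close> (\<open>separating_arcs\<close>). Hence, if the \<open>i\<close>-th arc contains \<open>x\<^sub>i\<close> of the \<open>m\<close> vertices
  of \<open>A\<close>, then \<open>2 W(A)\<close> is the sum of the products \<open>x\<^sub>i (m - x\<^sub>i)\<close>, that is,
  \<open>8 W(A) = n m\<^sup>2 - \<Sum> z\<^sub>i\<^sup>2\<close> with \<open>z\<^sub>i = m - 2 x\<^sub>i\<close>. All \<open>z\<^sub>i\<close> have the parity of \<open>m\<close>, and their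
  sum is \<open>m (n mod 2)\<close>, since every vertex lies on \<open>h\<close> arcs. For odd \<open>m\<close> every square is at
  least 1; for even \<open>m\<close> every square is at least \<open>2 z\<^sub>i\<close>. This bounds \<open>8 W(A)\<close> by a function of
  \<open>n\<close> and \<open>m\<close> alone (\<open>wiener_upper_bound\<close>).

  The vertices of the cycle can be enumerated so that blocks of consecutive terms attain this
  bound (\<open>balanced_enumeration\<close>). For \<open>n = 2 h + 1\<close> take the multiples of \<open>h\<close> modulo \<open>n\<close>, whose
  successive terms are as far apart as possible. For \<open>n = 2 h\<close> list the antipodal pairs one
  after the other: a block then consists of antipodal pairs and at most one further vertex,
  unless it has even length and begins in the middle of a pair. Placing the classes of even
  size before those of odd size avoids this exception. So every type of a surjective coloring is
  realized by one in which all classes are optimal at once, and the value of a weak maximizer is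
  the sum of the bounds over its type (\<open>weak_maximizer_value\<close>).

  A transfer changes only two terms of that sum, from sizes \<open>p \<le> q\<close> to \<open>p - 1\<close> and \<open>q + 1\<close>; the
  sign of the change is determined in \<open>eightfold_maximum_transfer\<close>. The bound is a convex function
  of the size, strictly so for odd \<open>n\<close>. For even \<open>n\<close> its increments from \<open>2 a - 1\<close> to \<open>2 a\<close> and
  from \<open>2 a\<close> to \<open>2 a + 1\<close> agree, but no other increments do, which leaves \<open>p = q = 2 a\<close> as the
  only case of equality.
\<close>

section \<open>Distances in a cycle\<close>

text \<open>The distance from \<open>x\<close> to the nearest multiple of \<open>n\<close>. The distance of two vertices of the
  cycle is the cyclic norm of their difference; working with integers modulo \<open>n\<close> makes this
  invariant under rotation and reflection.\<close>

definition cyclic_norm :: "nat \<Rightarrow> int \<Rightarrow> int" where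
  "cyclic_norm n x = min (x mod int n) (- x mod int n)"

lemma cyclic_norm_minus [simp]: "cyclic_norm n (- x) = cyclic_norm n x"
  by (simp add: cyclic_norm_def min.commute)

lemma cyclic_norm_cong: "[x = y] (mod int n) \<Longrightarrow> cyclic_norm n x = cyclic_norm n y"
  unfolding cyclic_norm_def cong_def by (metis mod_minus_cong)

lemma cyclic_norm_le_abs: "n > 0 \<Longrightarrow> cyclic_norm n x \<le> \<bar>x\<bar>"
  unfolding cyclic_norm_def
  by (smt (verit, best) zmod_le_nonneg_dividend)

lemma cyclic_norm_eq_abs:
  assumes "2 * \<bar>x\<bar> \<le> int n"
  shows "cyclic_norm n x = \<bar>x\<bar>"
proof -
  have pos: "cyclic_norm n y = y" if "0 \<le> y" "2 * y \<le> int n" for y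
  proof (cases "y = 0")
    case False
    with that have "y mod int n = y" "- y mod int n = int n - y"
      by (simp_all add: zmod_zminus1_eq_if)
    with that show ?thesis by (simp add: cyclic_norm_def)
  qed (simp add: cyclic_norm_def)
  show ?thesis
    using pos[of x] pos[of "- x"] assms by (cases "x \<ge> 0") auto
qed

text \<open>Lifting a walk to the integers, every edge is a step of \<open>\<plusminus>1\<close>. The walk is therefore at least
  as long as some integer congruent to the difference of its ends, which gives the lower bound
  for the distance.\<close>

lemma walk_displacement:
  assumes "p \<noteq> []" "successively (cycle_adj n) p"
  shows "\<exists>z. \<bar>z\<bar> \<le> int (length p) - 1 \<and> [int (last p) - int (hd p) = z] (mod int n)"
  using assms
proof (induction p rule: induct_list012)
  case (3 x y zs)
  then obtain z where z: "\<bar>z\<bar> \<le> int (length zs)" "[int (last (y # zs)) - int y = z] (mod int n)"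
    by auto
  have "cycle_adj n x y" using 3 by simp
  then obtain e where e: "\<bar>e\<bar> = 1" "[int x - int y = e] (mod int n)"
    unfolding cycle_adj_def by (metis abs_1 abs_minus_cancel)
  have "[(int (last (y # zs)) - int y) - (int x - int y) = z - e] (mod int n)"
    using z(2) e(2) by (rule cong_diff)
  then have "[int (last (x # y # zs)) - int (hd (x # y # zs)) = z - e] (mod int n)"
    by simp
  moreover have "\<bar>z - e\<bar> \<le> int (length (x # y # zs)) - 1" using z(1) e(1) by auto
  ultimately show ?case by blast
qed auto

lemma clockwise_path:
  assumes "u < n" "v < n"
  shows "\<exists>p. is_path (cycle_verts n) (cycle_adj n) u p v \<and>
             length p = Suc (nat ((int v - int u) mod int n))"
proof -
  define e where "e = nat ((int v - int u) mod int n)"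
  define p where "p = map (\<lambda>t. (u + t) mod n) [0..<Suc e]"
  have e: "int e = (int v - int u) mod int n" using assms by (simp add: e_def)
  have en: "e < n" using e assms
    by (metis (no_types, opaque_lifting) gr_implies_not0 gr0I of_nat_0_less_iff of_nat_less_iff pos_mod_bound)
  have "int ((u + e) mod n) = int v"
    using assms by (simp add: zmod_int e mod_add_right_eq)
  then have last: "last p = v" by (simp add: p_def)
  have "distinct p"
  proof -
    have "inj_on (\<lambda>t. (u + t) mod n) {0..<Suc e}"
    proof (rule inj_onI)
      fix s t assume "s \<in> {0..<Suc e}" "t \<in> {0..<Suc e}" "(u + s) mod n = (u + t) mod n"
      then have "[s = t] (mod n)" "s < n" "t < n"
        using en by (auto simp: cong_def[symmetric] cong_add_lcancel_nat)
      then show "s = t" by (simp add: cong_def)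
    qed
    then show ?thesis unfolding p_def distinct_map by (simp only: set_upt distinct_upt simp_thms)
  qed
  moreover have "successively (cycle_adj n) p"
    unfolding successively_conv_nth
  proof (intro allI impI)
    fix i assume i: "Suc i < length p"
    have neq: "p ! i \<noteq> p ! Suc i"
      using i \<open>distinct p\<close> nth_eq_iff_index_eq[of p i "Suc i"] by simp
    have "[int ((u + i) mod n) - int ((u + Suc i) mod n) = - 1] (mod int n)"
      by (simp add: cong_def zmod_int mod_diff_eq)
    then show "cycle_adj n (p ! i) (p ! Suc i)"
      using i neq unfolding cycle_adj_def p_def by (simp del: upt_Suc)
  qed
  ultimately have "is_path (cycle_verts n) (cycle_adj n) u p v"
    using last assms
    by (auto simp: is_path_def cycle_verts_def p_def hd_map simp del: upt_Suc)
  then show ?thesis by (auto simp: p_def e_def)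
qed

lemma cycle_adj_sym: "cycle_adj n x y \<Longrightarrow> cycle_adj n y x"
  unfolding cycle_adj_def
  by (metis (no_types, opaque_lifting) cong_minus_minus_iff minus_diff_eq minus_minus)

text \<open>Going clockwise from \<open>v\<close> to \<open>u\<close> and reversing gives the anticlockwise path from \<open>u\<close> to
  \<open>v\<close>.\<close>

lemma reversed_path:
  assumes "is_path (cycle_verts n) (cycle_adj n) u p v"
  shows "is_path (cycle_verts n) (cycle_adj n) v (rev p) u"
proof -
  have "successively (cycle_adj n) (rev p)"
    using assms unfolding is_path_def successively_rev
    by (auto intro: successively_mono cycle_adj_sym)
  then show ?thesis using assms by (auto simp: is_path_def hd_rev last_rev)
qed

lemma graph_dist_cycle:
  assumes "u < n" "v < n"
  shows "int (graph_dist (cycle_verts n) (cycle_adj n) u v) = cyclic_norm n (int v - int u)"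
proof -
  have n: "n > 0" using assms by simp
  let ?P = "\<lambda>l. \<exists>p. is_path (cycle_verts n) (cycle_adj n) u p v \<and> length p = Suc l"
  have P1: "?P (nat ((int v - int u) mod int n))" using clockwise_path[OF assms] .
  obtain p where "is_path (cycle_verts n) (cycle_adj n) v p u"
      "length p = Suc (nat ((int u - int v) mod int n))"
    using clockwise_path[OF assms(2,1)] by blast
  then have P2: "?P (nat (- (int v - int u) mod int n))"
    using reversed_path by (intro exI[of _ "rev p"]) simp
  have "?P (nat (cyclic_norm n (int v - int u)))"
    unfolding cyclic_norm_def min_def using P1 P2 by simp
  moreover have "nat (cyclic_norm n (int v - int u)) \<le> l" if "?P l" for l
  proof -
    from that obtain p where p: "is_path (cycle_verts n) (cycle_adj n) u p v" "length p = Suc l"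
      by blast
    then obtain z where "\<bar>z\<bar> \<le> int l" "[int v - int u = z] (mod int n)"
      using walk_displacement[of p n] by (auto simp: is_path_def)
    then show ?thesis using cyclic_norm_le_abs[OF n, of z] cyclic_norm_cong[of "int v - int u" z n] by simp
  qed
  ultimately have "graph_dist (cycle_verts n) (cycle_adj n) u v = nat (cyclic_norm n (int v - int u))"
    unfolding graph_dist_def by (rule Least_equality)
  moreover have "cyclic_norm n (int v - int u) \<ge> 0" using n by (simp add: cyclic_norm_def)
  ultimately show ?thesis by simp
qed

text \<open>Summing over ordered pairs lets the double sum factor arc by arc.\<close>

lemma double_wiener_cycle:
  assumes "A \<subseteq> cycle_verts n"
  shows "2 * int (wiener (cycle_verts n) (cycle_adj n) A)
    = (\<Sum>u\<in>A. \<Sum>v\<in>A. cyclic_norm n (int v - int u))"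
proof -
  have fin: "finite A" using assms finite_subset by (auto simp: cycle_verts_def)
  let ?d = "\<lambda>(u, v). cyclic_norm n (int v - int u)"
  let ?L = "{(u, v). u \<in> A \<and> v \<in> A \<and> u < v}" and ?R = "{(u, v). u \<in> A \<and> v \<in> A \<and> v < u}"
  let ?E = "{(u, v). u \<in> A \<and> v \<in> A \<and> u = v}"
  have finL: "finite ?L" and finR: "finite ?R" and finE: "finite ?E"
    by (rule finite_subset[of _ "A \<times> A"]; use fin in auto)+
  have "(\<Sum>u\<in>A. \<Sum>v\<in>A. cyclic_norm n (int v - int u)) = sum ?d (A \<times> A)"
    by (simp add: sum.cartesian_product)
  also have "A \<times> A = (?L \<union> ?R) \<union> ?E" by auto
  also have "sum ?d \<dots> = sum ?d ?L + sum ?d ?R + sum ?d ?E"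
  proof -
    have "(?L \<union> ?R) \<inter> ?E = {}" "?L \<inter> ?R = {}" by auto
    then show ?thesis
      using finL finR finE by (simp only: sum.union_disjoint finite_UnI)
  qed
  also have "sum ?d ?E = 0" by (intro sum.neutral) (auto simp: cyclic_norm_def)
  also have "sum ?d ?R = sum ?d ?L"
  proof (rule sum.reindex_bij_witness[of _ prod.swap prod.swap])
    fix a assume "a \<in> ?R"
    show "?d (prod.swap a) = ?d a"
      using cyclic_norm_minus[of n "int (snd a) - int (fst a)"] by (cases a) simp
  qed auto
  also have "sum ?d ?L = int (wiener (cycle_verts n) (cycle_adj n) A)"
    unfolding wiener_def of_nat_sum
  proof (rule sum.cong)
    fix x assume "x \<in> ?L"
    then obtain u v where "x = (u, v)" "u < n" "v < n"
      using assms by (cases x) (auto simp: cycle_verts_def)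
    then show "?d x = int (case x of (u, v) \<Rightarrow> graph_dist (cycle_verts n) (cycle_adj n) u v)"
      by (simp add: graph_dist_cycle)
  qed simp
  finally show ?thesis by simp
qed

section \<open>The upper bound from half-length arcs\<close>

text \<open>Whether \<open>u\<close> lies on the arc of \<open>n div 2\<close> consecutive vertices that starts at \<open>i\<close>; as a
  number, so that memberships can be multiplied and summed.\<close>

definition arc_indicator :: "nat \<Rightarrow> int \<Rightarrow> int \<Rightarrow> int" where
  "arc_indicator n i u = of_bool ((u - i) mod int n < int n div 2)"

text \<open>Describe an arc containing \<open>u\<close> by the position \<open>s < h\<close> that \<open>u\<close> has on it. With
  \<open>e = (v - u) mod n\<close>, the vertex \<open>v\<close> is off the arc iff \<open>(s + e) mod n \<ge> h\<close>. When \<open>e \<le> h\<close>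
  this holds exactly for the last \<open>e\<close> positions. When \<open>e > h\<close> it holds exactly for the first
  \<open>n - e\<close> positions, since for larger \<open>s\<close> the vertex \<open>v\<close> precedes \<open>u\<close> on the arc.\<close>

lemma separating_arcs:
  assumes n: "n > 0"
  shows "(\<Sum>i\<in>{0..<int n}. arc_indicator n i u * (1 - arc_indicator n i v)) = cyclic_norm n (v - u)"
proof -
  define N where "N = int n"
  define h where "h = N div 2"
  define e where "e = (v - u) mod N"
  have N: "N > 0" using n by (simp add: N_def)
  have e: "0 \<le> e" "e < N" using N by (simp_all add: e_def)
  have h: "2 * h \<le> N" "N \<le> 2 * h + 1" by (auto simp: h_def)
  have invol: "(u - (u - s) mod N) mod N = s" if "s \<in> {0..<N}" for s
    using that by (simp add: mod_diff_right_eq)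
  \<comment> \<open>On the arc starting at \<open>i\<close>, the position of \<open>v\<close> is that of \<open>u\<close> advanced by \<open>e\<close>.\<close>
  have shift: "(v - i) mod N = ((u - i) mod N + e) mod N" for i
    by (simp add: e_def mod_add_eq)
  have wrap: "(s + e) mod N = (if s + e < N then s + e else s + e - N)" if "0 \<le> s" "s < N" for s
  proof -
    have "(s + e) mod N = (s + e - N) mod N" by simp
    then show ?thesis using that e by (auto simp del: minus_mod_self2)
  qed
  have "(\<Sum>i\<in>{0..<N}. arc_indicator n i u * (1 - arc_indicator n i v))
      = (\<Sum>s\<in>{0..<N}. of_bool (s < h \<and> h \<le> (s + e) mod N))"
    by (rule sum.reindex_bij_witness[of _ "\<lambda>s. (u - s) mod N" "\<lambda>i. (u - i) mod N"])
       (use invol shift N in \<open>auto simp: arc_indicator_def N_def[symmetric] h_def[symmetric]\<close>)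
  also have "\<dots> = int (card {s \<in> {0..<N}. s < h \<and> h \<le> (s + e) mod N})"
    by (simp add: sum_of_bool_eq Int_def)
  also have "{s \<in> {0..<N}. s < h \<and> h \<le> (s + e) mod N}
      = (if e \<le> h then {h - e..<h} else {0..<N - e})"
    using h e N wrap by (auto split: if_splits)
  also have "int (card \<dots>) = (if e \<le> h then e else N - e)" using e by simp
  also have "\<dots> = cyclic_norm n (v - u)"
  proof -
    have "- (v - u) mod N = (if e = 0 then 0 else N - e)"
      unfolding e_def by (rule zmod_zminus1_eq_if)
    then show ?thesis using h e
      unfolding cyclic_norm_def N_def[symmetric] e_def[symmetric] by auto
  qed
  finally show ?thesis by (simp add: N_def)
qed

lemma arc_size:
  assumes n: "n > 0"
  shows "(\<Sum>i\<in>{0..<int n}. arc_indicator n i u) = int n div 2"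
proof -
  have "(\<Sum>i\<in>{0..<int n}. arc_indicator n i u) = (\<Sum>s\<in>{0..<int n}. of_bool (s < int n div 2))"
    by (rule sum.reindex_bij_witness[of _ "\<lambda>s. (u - s) mod int n" "\<lambda>i. (u - i) mod int n"])
       (use n in \<open>auto simp: arc_indicator_def mod_diff_right_eq\<close>)
  also have "\<dots> = int (card {0..<int n div 2})"
    using n by (subst sum_of_bool_eq) (auto simp del: card_atLeastLessThan_int intro!: arg_cong[of _ _ card])
  finally show ?thesis using n by simp
qed

text \<open>Eight times the largest Wiener index of an \<open>m\<close>-element set of vertices of the cycle on \<open>n\<close>
  vertices; the factor keeps all cases integral.\<close>

definition eightfold_maximum :: "nat \<Rightarrow> int \<Rightarrow> int" where
  "eightfold_maximum n m =
     (if even m then int n * m\<^sup>2 - 2 * m * (int n mod 2) else int n * m\<^sup>2 - int n)"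

text \<open>Here \<open>x i\<close> counts the vertices of \<open>A\<close> on the \<open>i\<close>-th arc, and \<open>z i\<close> measures how unevenly
  that arc splits \<open>A\<close>. The squares \<open>(z i)\<^sup>2\<close> are as small as the fixed parity and sum of the \<open>z i\<close>
  allow when all \<open>z i\<close> are \<open>\<plusminus>1\<close> for odd \<open>m\<close>, and all \<open>z i\<close> are \<open>0\<close> or \<open>2\<close> for even \<open>m\<close>.\<close>

lemma wiener_upper_bound:
  assumes n: "n > 0" and A: "A \<subseteq> cycle_verts n"
  shows "8 * int (wiener (cycle_verts n) (cycle_adj n) A) \<le> eightfold_maximum n (int (card A))"
proof -
  define m where "m = int (card A)"
  define I where "I = {0..<int n}"
  define x where "x i = (\<Sum>u\<in>A. arc_indicator n i (int u))" for i
  define z where "z i = m - 2 * x i" for i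
  have fin: "finite A" using A finite_subset by (auto simp: cycle_verts_def)
  have "2 * int (wiener (cycle_verts n) (cycle_adj n) A)
      = (\<Sum>u\<in>A. \<Sum>v\<in>A. \<Sum>i\<in>I. arc_indicator n i (int u) * (1 - arc_indicator n i (int v)))"
    unfolding double_wiener_cycle[OF A] I_def by (simp only: separating_arcs[OF n])
  also have "\<dots> = (\<Sum>i\<in>I. \<Sum>u\<in>A. \<Sum>v\<in>A. arc_indicator n i (int u) * (1 - arc_indicator n i (int v)))"
    by (subst (2) sum.swap, subst sum.swap) (rule refl)
  also have "\<dots> = (\<Sum>i\<in>I. x i * (m - x i))"
    by (simp only: sum_product[symmetric]) (simp add: x_def m_def sum_subtractf)
  finally have cuts: "2 * int (wiener (cycle_verts n) (cycle_adj n) A) = (\<Sum>i\<in>I. x i * (m - x i))" .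
  have "8 * int (wiener (cycle_verts n) (cycle_adj n) A) = (\<Sum>i\<in>I. m\<^sup>2 - (z i)\<^sup>2)"
  proof -
    have "8 * int (wiener (cycle_verts n) (cycle_adj n) A) = 4 * (\<Sum>i\<in>I. x i * (m - x i))"
      using cuts by simp
    also have "\<dots> = (\<Sum>i\<in>I. 4 * (x i * (m - x i)))" by (rule sum_distrib_left)
    also have "\<dots> = (\<Sum>i\<in>I. m\<^sup>2 - (z i)\<^sup>2)"
      by (intro sum.cong refl) (simp add: z_def power2_eq_square algebra_simps)
    finally show ?thesis .
  qed
  then have W: "8 * int (wiener (cycle_verts n) (cycle_adj n) A) = int n * m\<^sup>2 - (\<Sum>i\<in>I. (z i)\<^sup>2)"
    by (simp add: sum_subtractf I_def)
  have "(\<Sum>i\<in>I. x i) = m * (int n div 2)"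
    unfolding x_def by (subst sum.swap) (simp add: I_def arc_size[OF n] m_def)
  then have "(\<Sum>i\<in>I. z i) = m * int n - m * (2 * (int n div 2))"
    by (simp add: z_def sum_subtractf I_def sum_distrib_left[symmetric])
  also have "\<dots> = m * (int n mod 2)"
    by (simp add: minus_mult_div_eq_mod[symmetric] right_diff_distrib)
  finally have sumz: "(\<Sum>i\<in>I. z i) = m * (int n mod 2)" .
  show ?thesis
  proof (cases "even m")
    case True
    have "2 * z i \<le> (z i)\<^sup>2" for i
    proof -
      have "even (z i)" using True by (simp add: z_def)
      then have "z i \<le> 0 \<or> z i \<ge> 2" by presburger
      then have "0 \<le> z i * (z i - 2)" by (auto simp: zero_le_mult_iff)
      then show ?thesis by (simp add: power2_eq_square algebra_simps)
    qed
    then have "2 * (\<Sum>i\<in>I. z i) \<le> (\<Sum>i\<in>I. (z i)\<^sup>2)"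
      unfolding sum_distrib_left by (intro sum_mono)
    then show ?thesis using True W sumz by (simp add: eightfold_maximum_def m_def)
  next
    case False
    have "1 \<le> (z i)\<^sup>2" for i
    proof -
      have "z i \<noteq> 0" using False by (auto simp: z_def)
      then have "(z i)\<^sup>2 > 0" by simp
      then show ?thesis by linarith
    qed
    then have "(\<Sum>i\<in>I. 1) \<le> (\<Sum>i\<in>I. (z i)\<^sup>2)" by (intro sum_mono)
    then show ?thesis using False W by (simp add: eightfold_maximum_def m_def I_def)
  qed
qed

lemma cyclic_norm_0 [simp]: "cyclic_norm n 0 = 0"
  by (simp add: cyclic_norm_def)

section \<open>Optimal blocks in a cycle of odd length\<close>

lemma bij_betw_half_steps:
  assumes n: "n = 2 * h + 1"
  shows "bij_betw (\<lambda>t. t * h mod n) {..<n} (cycle_verts n)"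
proof -
  have cop: "coprime h n"
    using gcd_add_mult[of h 2 1] by (simp add: n coprime_iff_gcd_eq_1)
  have "inj_on (\<lambda>t. t * h mod n) {..<n}"
  proof (rule inj_onI)
    fix s t assume st: "s \<in> {..<n}" "t \<in> {..<n}" "s * h mod n = t * h mod n"
    then have "[s = t] (mod n)"
      using cong_mult_rcancel_nat[OF cop] by (simp add: cong_def)
    then show "s = t" using st by (simp add: cong_def)
  qed
  moreover have "(\<lambda>t. t * h mod n) ` {..<n} \<subseteq> {..<n}" using n by auto
  ultimately show ?thesis
    by (simp add: bij_betw_def endo_inj_surj cycle_verts_def lessThan_atLeast0)
qed

text \<open>Two steps of length \<open>h\<close> make a single step backwards, because \<open>2 h \<equiv> - 1\<close> modulo \<open>n\<close>. So an
  even number \<open>2 b\<close> of steps covers the distance \<open>b\<close>, and \<open>2 b + 1\<close> steps cover \<open>h - b\<close>.\<close>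

lemma half_step_distance:
  assumes n: "n = 2 * h + 1" and r: "r < n"
  shows "cyclic_norm n (int ((t + r) * h mod n) - int (t * h mod n))
    = (if even r then int r div 2 else int h - int r div 2)"
proof -
  define b where "b = int r div 2"
  have b: "0 \<le> b" "2 * b \<le> int r" by (simp_all add: b_def)
  have N: "int n = 2 * int h + 1" using n by simp
  have "[int ((t + r) * h mod n) - int (t * h mod n) = int r * int h] (mod int n)"
    by (simp add: cong_def zmod_int mod_diff_eq algebra_simps)
  then have red: "cyclic_norm n (int ((t + r) * h mod n) - int (t * h mod n)) = cyclic_norm n (int r * int h)"
    by (rule cyclic_norm_cong)
  show ?thesis
  proof (cases "even r")
    case True
    then have "int r = 2 * b" by (simp add: b_def)
    then have "int r * int h = - b + int n * b" by (simp add: N algebra_simps)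
    then have "[int r * int h = - b] (mod int n)" by (simp add: cong_iff_dvd_diff)
    then have "cyclic_norm n (int r * int h) = cyclic_norm n (- b)" by (rule cyclic_norm_cong)
    also have "\<dots> = b" using cyclic_norm_eq_abs[of b n] b r by simp
    finally show ?thesis using True red by (simp add: b_def)
  next
    case False
    then have rb: "int r = 2 * b + 1" unfolding b_def by presburger
    then have "int r * int h = (int h - b) + int n * b" by (simp add: N algebra_simps)
    then have "[int r * int h = int h - b] (mod int n)" by (simp add: cong_iff_dvd_diff)
    then have "cyclic_norm n (int r * int h) = cyclic_norm n (int h - b)" by (rule cyclic_norm_cong)
    also have "\<dots> = int h - b" using cyclic_norm_eq_abs[of "int h - b" n] b r rb N by simp
    finally show ?thesis using False red by (simp add: b_def)
  qed
qed

lemma sum_square_Suc: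
  fixes d :: "nat \<Rightarrow> nat \<Rightarrow> int"
  assumes "\<And>i j. d i j = d j i" and "d m m = 0"
  shows "(\<Sum>i<Suc m. \<Sum>j<Suc m. d i j) = (\<Sum>i<m. \<Sum>j<m. d i j) + 2 * (\<Sum>i<m. d i m)"
proof -
  have "(\<Sum>j<m. d m j) = (\<Sum>i<m. d i m)" by (intro sum.cong refl assms(1))
  then show ?thesis using assms(2) by (simp add: sum.distrib)
qed

text \<open>The total distance from the last term of a block to the \<open>m\<close> terms before it. The distances
  after \<open>2 b - 1\<close> and \<open>2 b\<close> steps add up to \<open>h + 1\<close>.\<close>

lemma half_step_distance_sum:
  "(\<Sum>r<m. if even (Suc r) then int (Suc r) div 2 else int h - int (Suc r) div 2)
    = (if even m then (int m div 2) * (int h + 1) else (int m div 2 + 1) * int h)"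
proof (induction m)
  case (Suc m)
  have step: "(\<Sum>r<Suc m. if even (Suc r) then int (Suc r) div 2 else int h - int (Suc r) div 2)
      = (if even m then (int m div 2) * (int h + 1) else (int m div 2 + 1) * int h)
        + (if even (Suc m) then int (Suc m) div 2 else int h - int (Suc m) div 2)"
    by (subst sum.lessThan_Suc) (rule arg_cong[OF Suc.IH])
  show ?case
  proof (cases "even m")
    case True
    then obtain a where m: "m = 2 * a" by blast
    then have "int m div 2 = int a" "int (Suc m) div 2 = int a" by simp_all
    then show ?thesis unfolding step using True by (simp add: distrib_left distrib_right)
  next
    case False
    then obtain a where m: "m = 2 * a + 1" by (elim oddE)
    then have "int m div 2 = int a" "int (Suc m) div 2 = int a + 1" by simp_all
    then show ?thesis unfolding step using False by (simp add: distrib_left distrib_right)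
  qed
qed simp

text \<open>Distances within a block depend only on the difference of the indices. Appending a term
  therefore adds \<open>half_step_distance_sum\<close> to the Wiener index, which is exactly the increment of
  the bound.\<close>

lemma wiener_half_step_chunk:
  assumes n: "n = 2 * h + 1" and "s + m \<le> n"
  shows "8 * int (wiener (cycle_verts n) (cycle_adj n) ((\<lambda>t. t * h mod n) ` {s..<s + m}))
    = eightfold_maximum n (int m)"
proof -
  let ?\<sigma> = "\<lambda>t. t * h mod n"
  define d where "d i j = cyclic_norm n (int (?\<sigma> (s + j)) - int (?\<sigma> (s + i)))" for i j
  have d_sym: "d i j = d j i" for i j
    using cyclic_norm_minus[of n "int (?\<sigma> (s + j)) - int (?\<sigma> (s + i))"] by (simp add: d_def)
  have inj: "inj_on (\<lambda>i. ?\<sigma> (s + i)) {..<m}"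
  proof -
    have "inj_on ?\<sigma> ((+) s ` {..<m})"
      using bij_betw_half_steps[OF n] assms(2)
      by (auto simp: bij_betw_def intro: inj_on_subset)
    then have "inj_on (?\<sigma> \<circ> (+) s) {..<m}" by (intro comp_inj_on) auto
    then show ?thesis by (simp add: o_def)
  qed
  have img: "?\<sigma> ` {s..<s + m} = (\<lambda>i. ?\<sigma> (s + i)) ` {..<m}"
  proof -
    have "{s..<s + m} = (+) s ` {..<m}" by (simp add: lessThan_atLeast0 add.commute)
    then show ?thesis by (simp only: image_image)
  qed
  have sub: "?\<sigma> ` {s..<s + m} \<subseteq> cycle_verts n" using n by (auto simp: cycle_verts_def)
  have W: "2 * int (wiener (cycle_verts n) (cycle_adj n) (?\<sigma> ` {s..<s + m}))
      = (\<Sum>i<m. \<Sum>j<m. d i j)"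
    unfolding double_wiener_cycle[OF sub] unfolding img
    by (simp add: sum.reindex[OF inj] d_def)
  have "4 * (\<Sum>i<l. \<Sum>j<l. d i j) = eightfold_maximum n (int l)" if "l \<le> m" for l
    using that
  proof (induction l)
    case (Suc l)
    have "(\<Sum>i<l. d i l) = (\<Sum>r<l. d (l - Suc r) l)"
      by (rule sum.nat_diff_reindex[symmetric])
    also have "\<dots> = (\<Sum>r<l. if even (Suc r) then int (Suc r) div 2 else int h - int (Suc r) div 2)"
    proof (rule sum.cong)
      fix r assume "r \<in> {..<l}"
      then have "s + l = (s + (l - Suc r)) + Suc r" "Suc r < n" using Suc.prems assms(2) by auto
      then show "d (l - Suc r) l = (if even (Suc r) then int (Suc r) div 2 else int h - int (Suc r) div 2)"
        using half_step_distance[OF n, of "Suc r" "s + (l - Suc r)"] by (simp only: d_def)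
    qed simp
    also note half_step_distance_sum
    finally have D: "(\<Sum>i<l. d i l)
      = (if even l then (int l div 2) * (int h + 1) else (int l div 2 + 1) * int h)" .
    have "4 * (\<Sum>i<Suc l. \<Sum>j<Suc l. d i j)
        = eightfold_maximum n (int l) + 8 * (\<Sum>i<l. d i l)"
      using Suc sum_square_Suc[of d l, OF d_sym] by (simp add: d_def del: sum.lessThan_Suc)
    also have "\<dots> = eightfold_maximum n (int (Suc l))"
    proof (cases "even l")
      case True
      then obtain a where "l = 2 * a" by blast
      then show ?thesis unfolding D
        by (simp add: eightfold_maximum_def n power2_eq_square algebra_simps)
    next
      case False
      then obtain a where "l = 2 * a + 1" by (elim oddE)
      then show ?thesis unfolding D
        by (simp add: eightfold_maximum_def n power2_eq_square algebra_simps)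
    qed
    finally show ?case .
  qed (simp add: eightfold_maximum_def)
  from this[of m] W show ?thesis by simp
qed

section \<open>Optimal blocks in a cycle of even length\<close>

lemma antipodal_distances:
  assumes n: "n = 2 * h" and h: "h > 0"
  shows "cyclic_norm n x + cyclic_norm n (x + int h) = int h"
proof -
  define y where "y = x mod int n"
  have y: "0 \<le> y" "y < 2 * int h" using n h by (simp_all add: y_def)
  have red: "cyclic_norm n x = cyclic_norm n y" "cyclic_norm n (x + int h) = cyclic_norm n (y + int h)"
    by (rule cyclic_norm_cong, simp add: cong_def y_def mod_add_left_eq)+
  show ?thesis
  proof (cases "y \<le> int h")
    case True
    have "cyclic_norm n (y + int h) = cyclic_norm n (y - int h)"
      by (rule cyclic_norm_cong) (simp add: cong_iff_dvd_diff n)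
    then show ?thesis
      using cyclic_norm_eq_abs[of y n] cyclic_norm_eq_abs[of "y - int h" n] True y n red by simp
  next
    case False
    have "cyclic_norm n (y + int h) = cyclic_norm n (y - int h)"
      "cyclic_norm n y = cyclic_norm n (y - 2 * int h)"
      by (rule cyclic_norm_cong, simp add: cong_iff_dvd_diff n)+
    then show ?thesis
      using cyclic_norm_eq_abs[of "y - 2 * int h" n] cyclic_norm_eq_abs[of "y - int h" n] False y n red
      by simp
  qed
qed

text \<open>Every point \<open>x\<close> lies on a shortest path between the two vertices of any antipodal pair, so
  its distances to them add up to \<open>h\<close>, and the vertices of \<open>P\<close> contribute \<open>h / 2\<close> on average.\<close>

lemma antipodal_closed_distance_sum:
  assumes n: "n = 2 * h" and h: "h > 0" and P: "P \<subseteq> cycle_verts n"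
    and closed: "\<And>u. u \<in> P \<Longrightarrow> (u + h) mod n \<in> P"
  shows "2 * (\<Sum>u\<in>P. cyclic_norm n (int u - x)) = int (card P) * int h"
proof -
  have invol: "((u + h) mod n + h) mod n = u" if "u \<in> P" for u
  proof -
    have "((u + h) mod n + h) mod n = (u + n) mod n" by (simp add: mod_add_left_eq n mult_2 add.assoc)
    then show ?thesis using P that by (auto simp: cycle_verts_def)
  qed
  have "(\<Sum>u\<in>P. cyclic_norm n (int u - x)) = (\<Sum>u\<in>P. cyclic_norm n (int u - x + int h))"
  proof (rule sum.reindex_bij_witness[of _ "\<lambda>u. (u + h) mod n" "\<lambda>u. (u + h) mod n"])
    fix u assume u: "u \<in> P"
    have "[int w - x + int h = int ((w + h) mod n) - x] (mod int n)" for w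
      by (simp add: cong_def zmod_int mod_diff_left_eq algebra_simps)
    from this[of "(u + h) mod n"]
    show "cyclic_norm n (int ((u + h) mod n) - x + int h) = cyclic_norm n (int u - x)"
      unfolding invol[OF u] by (rule cyclic_norm_cong)
  qed (use closed invol in auto)
  then have "2 * (\<Sum>u\<in>P. cyclic_norm n (int u - x))
      = (\<Sum>u\<in>P. cyclic_norm n (int u - x) + cyclic_norm n (int u - x + int h))"
    by (simp add: sum.distrib)
  then show ?thesis by (simp add: antipodal_distances[OF n h])
qed

lemma wiener_antipodal_closed:
  assumes n: "n = 2 * h" and h: "h > 0" and P: "P \<subseteq> cycle_verts n"
    and closed: "\<And>u. u \<in> P \<Longrightarrow> (u + h) mod n \<in> P"
  shows "8 * int (wiener (cycle_verts n) (cycle_adj n) P) = int n * (int (card P))\<^sup>2"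
    and "\<lbrakk>v \<in> cycle_verts n; v \<notin> P\<rbrakk> \<Longrightarrow>
      8 * int (wiener (cycle_verts n) (cycle_adj n) (insert v P)) = int n * ((int (card P) + 1)\<^sup>2 - 1)"
proof -
  have fin: "finite P" using P finite_subset by (auto simp: cycle_verts_def)
  have S: "2 * (\<Sum>u\<in>P. cyclic_norm n (int u - x)) = int (card P) * int h" for x
    using antipodal_closed_distance_sum[OF n h P closed] .
  have "2 * (\<Sum>v\<in>P. \<Sum>u\<in>P. cyclic_norm n (int u - int v)) = (\<Sum>v\<in>P. int (card P) * int h)"
    by (subst sum_distrib_left) (simp only: S)
  then have PP: "2 * (\<Sum>v\<in>P. \<Sum>u\<in>P. cyclic_norm n (int u - int v)) = (int (card P))\<^sup>2 * int h"
    by (simp add: power2_eq_square)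
  then show "8 * int (wiener (cycle_verts n) (cycle_adj n) P) = int n * (int (card P))\<^sup>2"
    using double_wiener_cycle[OF P] by (simp add: n mult.commute)
  assume v: "v \<in> cycle_verts n" "v \<notin> P"
  have flip: "(\<Sum>u\<in>P. cyclic_norm n (int v - int u)) = (\<Sum>u\<in>P. cyclic_norm n (int u - int v))"
  proof (rule sum.cong)
    fix u show "cyclic_norm n (int v - int u) = cyclic_norm n (int u - int v)"
      using cyclic_norm_minus[of n "int u - int v"] by simp
  qed simp
  have "2 * int (wiener (cycle_verts n) (cycle_adj n) (insert v P))
      = 2 * (\<Sum>u\<in>P. cyclic_norm n (int u - int v)) + (\<Sum>v\<in>P. \<Sum>u\<in>P. cyclic_norm n (int u - int v))"
    using double_wiener_cycle[of "insert v P" n] v P fin flip by (simp add: sum.distrib)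
  then show "8 * int (wiener (cycle_verts n) (cycle_adj n) (insert v P)) = int n * ((int (card P) + 1)\<^sup>2 - 1)"
    using S[of "int v"] PP by (simp add: n power2_eq_square algebra_simps)
qed

text \<open>The enumeration \<open>0, h, 1, h + 1, \<dots>\<close>, in which the terms with indices \<open>2 i\<close> and \<open>2 i + 1\<close> are
  antipodal.\<close>

lemma bij_betw_antipodal_pairs:
  assumes n: "n = 2 * h"
  shows "bij_betw (\<lambda>t. t div 2 + t mod 2 * h) {..<n} (cycle_verts n)"
proof (rule bij_betw_byWitness[where f' = "\<lambda>v. if v < h then 2 * v else 2 * (v - h) + 1"])
  have t: "t div 2 < h \<and> (t mod 2 = 0 \<and> 2 * (t div 2) = t \<or> t mod 2 = 1 \<and> 2 * (t div 2) + 1 = t)"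
    if "t < n" for t
    using that n by presburger
  show "\<forall>t\<in>{..<n}. (if t div 2 + t mod 2 * h < h then 2 * (t div 2 + t mod 2 * h)
      else 2 * (t div 2 + t mod 2 * h - h) + 1) = t"
    using t by force
  show "(\<lambda>t. t div 2 + t mod 2 * h) ` {..<n} \<subseteq> cycle_verts n"
    unfolding cycle_verts_def n using t[unfolded n] by force
  show "\<forall>v\<in>cycle_verts n. (if v < h then 2 * v else 2 * (v - h) + 1) div 2
      + (if v < h then 2 * v else 2 * (v - h) + 1) mod 2 * h = v"
    by simp
  show "(\<lambda>v. if v < h then 2 * v else 2 * (v - h) + 1) ` cycle_verts n \<subseteq> {..<n}"
    by (auto simp: cycle_verts_def n)
qed

text \<open>The parity condition leaves at most one vertex of the block without its antipode: the last
  vertex if \<open>s\<close> is even, the first one if \<open>s\<close> is odd. For odd \<open>s\<close> and even \<open>m > 0\<close>, two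
  vertices that are not antipodal to each other would be left over.\<close>

lemma wiener_antipodal_chunk:
  assumes n: "n = 2 * h" and h: "h > 0" and sm: "s + m \<le> n" and par: "even s \<or> odd m"
  shows "8 * int (wiener (cycle_verts n) (cycle_adj n) ((\<lambda>t. t div 2 + t mod 2 * h) ` {s..<s + m}))
    = eightfold_maximum n (int m)"
proof -
  let ?\<sigma> = "\<lambda>t. t div 2 + t mod 2 * h"
  note bij = bij_betw_antipodal_pairs[OF n]
  have sub: "?\<sigma> ` {a..<b} \<subseteq> cycle_verts n" if "b \<le> n" for a b
    using bij_betw_imp_surj_on[OF bij] that by fastforce
  have inj: "inj_on ?\<sigma> {..<n}" using bij by (simp add: bij_betw_def)
  have card: "card (?\<sigma> ` {a..<b}) = b - a" if "b \<le> n" for a b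
    using that by (subst card_image) (auto intro: inj_on_subset[OF inj])
  have mem: "?\<sigma> t \<notin> ?\<sigma> ` {a..<b}" if "b \<le> n" "t < n" "t \<notin> {a..<b}" for a b t
    using that inj by (auto dest: inj_onD)
  have closed: "(u + h) mod n \<in> ?\<sigma> ` {a..<b}"
    if "u \<in> ?\<sigma> ` {a..<b}" "even a" "even b" "b \<le> n" for a b u
  proof -
    from that obtain t where t: "u = ?\<sigma> t" "a \<le> t" "t < b" by auto
    show ?thesis
    proof (cases "even t")
      case True
      then have "(u + h) mod n = ?\<sigma> (Suc t)" using t that n by (auto simp: mod_2_eq_odd)
      moreover have "Suc t < b" using True t that by (metis Suc_lessI even_Suc)
      ultimately show ?thesis using t by (intro image_eqI[of _ _ "Suc t"]) auto
    next
      case False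
      then obtain c where c: "t = Suc c" "even c" by (metis even_Suc not0_implies_Suc even_zero)
      then have "u + h = c div 2 + n" using t n by (simp add: mod_2_eq_odd)
      moreover have "c div 2 < n" using c t that by auto
      ultimately have "(u + h) mod n = ?\<sigma> c" using c by simp
      moreover have "a \<le> c" using c t that by (metis even_Suc le_SucE)
      ultimately show ?thesis using c t by (intro image_eqI[of _ _ c]) auto
    qed
  qed
  consider "even s" "even m" | "even s" "odd m" | "odd s" "odd m" using par by blast
  then show ?thesis
  proof cases
    case 1
    then show ?thesis
      using wiener_antipodal_closed(1)[OF n h sub[of "s + m" s] closed[of _ s "s + m"]] sm card[of "s + m" s]
      by (simp add: eightfold_maximum_def n)
  next
    case 2
    then obtain l where l: "m = Suc l" "even l" by (metis even_Suc not0_implies_Suc even_zero)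
    have "{s..<s + m} = insert (s + l) {s..<s + l}" using l by auto
    then show ?thesis
      using wiener_antipodal_closed(2)[OF n h sub[of "s + l" s] closed[of _ s "s + l"], of "?\<sigma> (s + l)"]
        sm card[of "s + l" s] mem[of "s + l" "s + l" s] sub[of "s + m" s] 2 l
      by (simp add: eightfold_maximum_def n algebra_simps)
  next
    case 3
    then obtain l where l: "m = Suc l" "even l" by (metis even_Suc not0_implies_Suc even_zero)
    have "{s..<s + m} = insert s {Suc s..<Suc s + l}" using l by auto
    then show ?thesis
      using wiener_antipodal_closed(2)[OF n h sub[of "Suc s + l" "Suc s"] closed[of _ "Suc s" "Suc s + l"], of "?\<sigma> s"]
        sm card[of "Suc s + l" "Suc s"] mem[of "Suc s + l" s "Suc s"] sub[of "s + m" s] 3 l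
      by (simp add: eightfold_maximum_def n algebra_simps)
  qed
qed

lemma balanced_enumeration:
  assumes n: "n > 0"
  obtains \<sigma> where "bij_betw \<sigma> {..<n} (cycle_verts n)"
    and "\<And>s m. \<lbrakk>s + m \<le> n; even s \<or> odd m\<rbrakk> \<Longrightarrow>
      8 * int (wiener (cycle_verts n) (cycle_adj n) (\<sigma> ` {s..<s + m})) = eightfold_maximum n (int m)"
proof (cases "even n")
  case True
  then obtain h where h: "n = 2 * h" by blast
  then have "h > 0" using n by simp
  show ?thesis
    by (rule that[OF bij_betw_antipodal_pairs[OF h] wiener_antipodal_chunk[OF h \<open>h > 0\<close>]])
next
  case False
  then obtain h where h: "n = 2 * h + 1" by (elim oddE)
  show ?thesis
    by (rule that[OF bij_betw_half_steps[OF h] wiener_half_step_chunk[OF h]])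
qed

section \<open>Colorings of prescribed type\<close>

lemma sum_classes:
  fixes k :: nat
  shows "(\<Sum>i = 1..k. F i) = sum_list (map F [1..<Suc k])"
  by (simp only: interv_sum_list_conv_sum_set_nat set_upt atLeastLessThanSuc_atLeastAtMost)

lemma coloring_type_length: "length (coloring_type V k f) = k"
  by (simp add: coloring_type_def)

lemma coloring_type_set:
  "set (coloring_type V k f) = (\<lambda>i. int (card (color_class V f i))) ` {1..k}"
  by (simp add: coloring_type_def atLeastLessThanSuc_atLeastAtMost del: upt_Suc)

text \<open>Sorting the class sizes does not affect sums over them.\<close>

lemma coloring_type_sum:
  "sum_list (map F (coloring_type V k f)) = (\<Sum>i = 1..k. F (int (card (color_class V f i))))"
  unfolding coloring_type_def sum_classes
  by (simp only: sum_mset_sum_list[symmetric] mset_map mset_sort map_map image_mset.compositionality o_def)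

lemma color_class_card_pos:
  assumes "surj_coloring V k f" "finite V" "i \<in> {1..k}"
  shows "card (color_class V f i) > 0"
proof -
  have "i \<in> f ` V" using assms by (simp add: surj_coloring_def)
  then have "color_class V f i \<noteq> {}" by (auto simp: color_class_def)
  then show ?thesis using assms(2) by (simp add: card_gt_0_iff color_class_def)
qed

lemma color_class_card_sum:
  assumes "surj_coloring V k f" "finite V"
  shows "(\<Sum>i = 1..k. card (color_class V f i)) = card V"
proof -
  have "card (\<Union>i\<in>{1..k}. color_class V f i) = (\<Sum>i = 1..k. card (color_class V f i))"
    by (rule card_UN_disjoint) (use assms(2) in \<open>auto simp: color_class_def\<close>)
  moreover have "(\<Union>i\<in>{1..k}. color_class V f i) = V"
    using assms(1) by (auto simp: color_class_def surj_coloring_def)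
  ultimately show ?thesis by simp
qed

text \<open>Cut the enumeration into consecutive blocks and color each term by the number of the first
  block that ends after it. Blocks are nonempty, so every color occurs.\<close>

lemma coloring_with_chunk_classes:
  fixes \<sigma> :: "nat \<Rightarrow> 'a" and L :: "nat list"
  assumes \<sigma>: "bij_betw \<sigma> {..<sum_list L} V" and pos: "\<forall>x\<in>set L. x > 0"
  obtains g where "surj_coloring V (length L) g"
    and "\<And>i. i < length L \<Longrightarrow>
      color_class V g (Suc i) = \<sigma> ` {sum_list (take i L)..<sum_list (take i L) + L ! i}"
proof -
  define S where "S i = sum_list (take i L)" for i
  define c where "c t = (LEAST i. t < S (Suc i))" for t
  define \<tau> where "\<tau> = the_inv_into {..<sum_list L} \<sigma>"
  define g where "g v = Suc (c (\<tau> v))" for v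
  have S_Suc: "S (Suc i) = S i + L ! i" if "i < length L" for i
    using that by (simp add: S_def take_Suc_conv_app_nth)
  have S_mono: "S i \<le> S j" if "i \<le> j" for i j
  proof -
    from that obtain l where "j = i + l" using le_Suc_ex by blast
    then show ?thesis by (simp add: S_def take_add)
  qed
  have c_eq: "c t = i" if "S i \<le> t" "t < S (Suc i)" for i t
    unfolding c_def
  proof (rule Least_equality)
    fix y assume "t < S (Suc y)"
    then show "i \<le> y" using that(1) S_mono[of "Suc y" i] by (meson leD leI le_trans not_less_eq_eq)
  qed fact
  have c_bounds: "c t < length L \<and> S (c t) \<le> t \<and> t < S (Suc (c t))" if t: "t < sum_list L" for t
  proof -
    have L: "L \<noteq> []" using t by auto
    then have last: "t < S (Suc (length L - 1))" using t by (simp add: S_def)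
    have up: "t < S (Suc (c t))" unfolding c_def by (rule LeastI) (rule last)
    have "c t \<le> length L - 1" unfolding c_def by (rule Least_le) (rule last)
    moreover have "S (c t) \<le> t"
    proof (cases "c t")
      case (Suc i)
      then have "\<not> t < S (Suc i)" unfolding c_def by (metis lessI not_less_Least)
      then show ?thesis using Suc by simp
    qed (simp add: S_def)
    ultimately show ?thesis using up L by (cases L) auto
  qed
  have \<tau>\<sigma>: "\<tau> (\<sigma> t) = t" if "t < sum_list L" for t
    unfolding \<tau>_def using that \<sigma> by (auto simp: bij_betw_def the_inv_into_f_f)
  have V: "V = \<sigma> ` {..<sum_list L}" using \<sigma> by (simp add: bij_betw_def)
  have cc: "color_class V g (Suc i) = \<sigma> ` {S i..<S i + L ! i}" if i: "i < length L" for i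
  proof -
    have "S (Suc i) \<le> sum_list L" using S_mono[of "Suc i" "length L"] i by (simp add: S_def)
    then have "{t \<in> {..<sum_list L}. c t = i} = {S i..<S (Suc i)}"
      using c_bounds c_eq by fastforce
    moreover have "color_class V g (Suc i) = \<sigma> ` {t \<in> {..<sum_list L}. c t = i}"
      using \<tau>\<sigma> by (auto simp: color_class_def g_def V)
    ultimately show ?thesis using S_Suc[OF i] by simp
  qed
  have "surj_coloring V (length L) g"
    unfolding surj_coloring_def
  proof (intro equalityI subsetI)
    fix x assume "x \<in> g ` V"
    then obtain t where "t < sum_list L" "x = Suc (c t)" using \<tau>\<sigma> by (auto simp: g_def V)
    then show "x \<in> {1..length L}" using c_bounds[of t] by auto
  next
    fix x assume "x \<in> {1..length L}"
    then obtain i where i: "x = Suc i" "i < length L" by (cases x) auto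
    then have "color_class V g x \<noteq> {}" using cc[of i] pos by (auto simp: nth_mem)
    then show "x \<in> g ` V" by (auto simp: color_class_def)
  qed
  then show ?thesis using that cc by (simp add: S_def)
qed

text \<open>If the even sizes come first, a block of even size is preceded only by blocks of even size,
  so it starts at an even position. This is the condition of \<open>balanced_enumeration\<close>.\<close>

lemma evens_first_parity:
  fixes L0 :: "nat list"
  defines "L \<equiv> filter even L0 @ filter odd L0"
  assumes i: "i < length L"
  shows "even (sum_list (take i L)) \<or> odd (L ! i)"
proof (cases "i < length (filter even L0)")
  case True
  have sum_even: "even (sum_list xs)" if "\<forall>x\<in>set xs. even x" for xs :: "nat list"
    using that by (induction xs) auto
  have "set (take i L) \<subseteq> set (filter even L0)"
    using True set_take_subset[of i "filter even L0"] by (simp add: L_def)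
  then have "even (sum_list (take i L))" by (intro sum_even) auto
  then show ?thesis ..
next
  case False
  then have "L ! i \<in> set (filter odd L0)"
    using i by (simp add: L_def nth_append del: set_filter)
  then show ?thesis by simp
qed

lemma balanced_coloring_exists:
  assumes n: "n > 0" and f: "surj_coloring (cycle_verts n) k f"
  obtains g where "surj_coloring (cycle_verts n) k g"
    and "coloring_type (cycle_verts n) k g = coloring_type (cycle_verts n) k f"
    and "\<And>i. i \<in> {1..k} \<Longrightarrow>
      8 * int (wiener (cycle_verts n) (cycle_adj n) (color_class (cycle_verts n) g i))
        = eightfold_maximum n (int (card (color_class (cycle_verts n) g i)))"
proof -
  let ?V = "cycle_verts n"
  have fin: "finite ?V" and cardV: "card ?V = n" by (simp_all add: cycle_verts_def)
  define L0 where "L0 = map (\<lambda>i. card (color_class ?V f i)) [1..<Suc k]"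
  define L where "L = filter even L0 @ filter odd L0"
  have msetL: "mset L = mset L0"
    unfolding L_def mset_append mset_filter by (rule multiset_partition[symmetric])
  have lenL: "length L = k" using arg_cong[OF msetL, of size] by (simp add: L0_def)
  have sumL: "sum_list L = n"
  proof -
    have "sum_list L = sum_list L0" using msetL by (metis sum_mset_sum_list)
    then show ?thesis
      using color_class_card_sum[OF f fin] cardV by (simp only: L0_def sum_classes)
  qed
  have posL: "\<forall>x\<in>set L. x > 0"
  proof -
    have "set L = set L0" by (auto simp: L_def)
    also have "\<dots> = (\<lambda>i. card (color_class ?V f i)) ` {1..k}"
      by (simp add: L0_def atLeastLessThanSuc_atLeastAtMost del: upt_Suc)
    finally show ?thesis using color_class_card_pos[OF f fin] by simp
  qed
  obtain \<sigma> where \<sigma>: "bij_betw \<sigma> {..<n} ?V"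
    and chunk: "\<And>s m. \<lbrakk>s + m \<le> n; even s \<or> odd m\<rbrakk> \<Longrightarrow>
      8 * int (wiener ?V (cycle_adj n) (\<sigma> ` {s..<s + m})) = eightfold_maximum n (int m)"
    by (rule balanced_enumeration[OF n]) (rule that; blast)
  have \<sigma>': "bij_betw \<sigma> {..<sum_list L} ?V" using \<sigma> by (simp only: sumL)
  obtain g where g: "surj_coloring ?V (length L) g"
    and classes: "\<And>i. i < length L \<Longrightarrow>
      color_class ?V g (Suc i) = \<sigma> ` {sum_list (take i L)..<sum_list (take i L) + L ! i}"
    by (rule coloring_with_chunk_classes[OF \<sigma>' posL]) (rule that; blast)
  have fits: "sum_list (take i L) + L ! i \<le> n" if "i < length L" for i
  proof -
    have "sum_list (take i L) + L ! i = sum_list (take (Suc i) L)"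
      using that by (simp add: take_Suc_conv_app_nth)
    also have "\<dots> \<le> sum_list (take (Suc i) L) + sum_list (drop (Suc i) L)" by simp
    also have "\<dots> = n" unfolding sumL[symmetric] sum_list_append[symmetric] by simp
    finally show ?thesis .
  qed
  have card: "card (color_class ?V g (Suc i)) = L ! i" if "i < length L" for i
  proof -
    have "inj_on \<sigma> {sum_list (take i L)..<sum_list (take i L) + L ! i}"
      using \<sigma> fits[OF that] by (auto simp: bij_betw_def intro: inj_on_subset)
    then show ?thesis using that by (simp add: classes card_image)
  qed
  have "map (\<lambda>i. card (color_class ?V g i)) [1..<Suc k] = L"
    by (rule nth_equalityI) (use card lenL in \<open>simp_all del: upt_Suc\<close>)
  then have "map (\<lambda>i. int (card (color_class ?V g i))) [1..<Suc k] = map int L" by fastforce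
  moreover have "map (\<lambda>i. int (card (color_class ?V f i))) [1..<Suc k] = map int L0"
    by (simp add: L0_def del: upt_Suc)
  ultimately have "coloring_type ?V k g = coloring_type ?V k f"
    unfolding coloring_type_def using msetL
    by (metis mset_map properties_for_sort mset_sort sorted_sort)
  moreover have "8 * int (wiener ?V (cycle_adj n) (color_class ?V g i))
      = eightfold_maximum n (int (card (color_class ?V g i)))" if "i \<in> {1..k}" for i
  proof -
    from that obtain l where "i = Suc l" "l < length L" using lenL by (cases i) auto
    then show ?thesis
      using chunk[OF fits[of l]] evens_first_parity[of l L0] card[of l] by (simp add: classes L_def[symmetric])
  qed
  ultimately show ?thesis using that g lenL by blast
qed

text \<open>A weak maximizer is squeezed between the classwise upper bound and the balanced coloring of
  the same type, for which every class attains its bound.\<close>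

lemma weak_maximizer_value:
  assumes n: "n > 0" and f: "weak_maximizer (cycle_verts n) (cycle_adj n) k f"
  shows "8 * int (wiener_coloring (cycle_verts n) (cycle_adj n) k f)
    = sum_list (map (eightfold_maximum n) (coloring_type (cycle_verts n) k f))"
proof -
  let ?V = "cycle_verts n" and ?T = "coloring_type (cycle_verts n) k"
  have surj: "surj_coloring ?V k f" using f by (simp add: weak_maximizer_def)
  obtain g where g: "surj_coloring ?V k g" "?T g = ?T f"
    and opt: "\<And>i. i \<in> {1..k} \<Longrightarrow> 8 * int (wiener ?V (cycle_adj n) (color_class ?V g i))
        = eightfold_maximum n (int (card (color_class ?V g i)))"
    by (rule balanced_coloring_exists[OF n surj]) (rule that; blast)
  have "8 * int (wiener_coloring ?V (cycle_adj n) k f)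
      = (\<Sum>i = 1..k. 8 * int (wiener ?V (cycle_adj n) (color_class ?V f i)))"
    by (simp add: wiener_coloring_def sum_distrib_left)
  also have "\<dots> \<le> (\<Sum>i = 1..k. eightfold_maximum n (int (card (color_class ?V f i))))"
    by (intro sum_mono wiener_upper_bound[OF n]) (auto simp: color_class_def)
  finally have upper: "8 * int (wiener_coloring ?V (cycle_adj n) k f)
      \<le> sum_list (map (eightfold_maximum n) (?T f))"
    by (simp only: coloring_type_sum)
  have "sum_list (map (eightfold_maximum n) (?T f)) = sum_list (map (eightfold_maximum n) (?T g))"
    by (simp only: g)
  also have "\<dots> = (\<Sum>i = 1..k. 8 * int (wiener ?V (cycle_adj n) (color_class ?V g i)))"
    unfolding coloring_type_sum by (intro sum.cong refl opt[symmetric])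
  also have "\<dots> = 8 * int (wiener_coloring ?V (cycle_adj n) k g)"
    by (simp add: wiener_coloring_def sum_distrib_left)
  also have "\<dots> \<le> 8 * int (wiener_coloring ?V (cycle_adj n) k f)"
    using f g by (simp add: weak_maximizer_def)
  finally show ?thesis using upper by simp
qed

section \<open>The effect of a transfer\<close>

text \<open>The quadratic part \<open>n m\<^sup>2\<close> of the bound contributes \<open>2 n (q - p + 1)\<close>. The rest
  depends on parities. It is at least \<open>- 2 n\<close> when \<open>p\<close> and \<open>q\<close> are even, with equality only for
  even \<open>n\<close>; at least \<open>- 2 (q - p + 1)\<close> when only \<open>p\<close> is even; and nonnegative for odd \<open>p\<close>,
  where \<open>p + q \<le> n\<close> settles the case of two odd sizes.\<close>

lemma eightfold_maximum_transfer:
  assumes "p \<le> q" and "p \<ge> 2" and "p + q \<le> int n"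
  defines "D \<equiv> eightfold_maximum n (p - 1) + eightfold_maximum n (q + 1)
      - eightfold_maximum n p - eightfold_maximum n q"
  shows "if even n \<and> p = q \<and> even p then D = 0 else D > 0"
proof -
  define N where "N = int n"
  define e where "e = N mod 2"
  have e: "e = 0 \<or> e = 1" and evn: "even n \<longleftrightarrow> e = 0" unfolding e_def N_def by presburger+
  have N: "N \<ge> p + q" "N \<ge> 4" using assms by (simp_all add: N_def)
  define X where "X = N * (q - p)"
  have X: "0 \<le> X" unfolding X_def using N assms(1) by (intro mult_nonneg_nonneg) auto
  have X0: "X = 0" if "p = q" using that by (simp add: X_def)
  have X1: "X > 0" if "p \<noteq> q" unfolding X_def using that N assms(1) by (intro mult_pos_pos) auto
  show ?thesis
  proof (cases "even p"; cases "even q")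
    assume "even p" "even q"
    then have "D = 2 * X + 2 * e * (p + q)"
      by (simp add: D_def X_def eightfold_maximum_def N_def[symmetric] e_def[symmetric] power2_eq_square algebra_simps)
    then show ?thesis using e evn X X0 X1 assms(1,2) \<open>even q\<close> by (cases "p = q") auto
  next
    assume "even p" "odd q"
    then have D: "D = 2 * X + 2 * N - 2 * e * (q - p + 1)"
      by (simp add: D_def X_def eightfold_maximum_def N_def[symmetric] e_def[symmetric] power2_eq_square algebra_simps)
    have "p \<noteq> q" using \<open>even p\<close> \<open>odd q\<close> by blast
    then show ?thesis using D e X assms(1,2) N by auto
  next
    assume "odd p" "even q"
    then have "D = 2 * X + 2 * N + 2 * e * (q - p + 1)"
      by (simp add: D_def X_def eightfold_maximum_def N_def[symmetric] e_def[symmetric] power2_eq_square algebra_simps)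
    then show ?thesis using e X assms(1,2) N \<open>odd p\<close> by auto
  next
    assume "odd p" "odd q"
    then have "D = 2 * X + 4 * N - 2 * e * (p + q)"
      by (simp add: D_def X_def eightfold_maximum_def N_def[symmetric] e_def[symmetric] power2_eq_square algebra_simps)
    then show ?thesis using e X assms(1,2) N \<open>odd p\<close> by auto
  qed
qed

lemma sum_list_two_updates:
  fixes F :: "'a \<Rightarrow> int"
  assumes "a < length x" "b < length x" "a \<noteq> b"
  shows "sum_list (map F (x[a := u, b := v])) = sum_list (map F x) - F (x ! a) - F (x ! b) + F u + F v"
proof -
  have upd: "sum_list (xs[i := y]) = sum_list xs - xs ! i + y" if "i < length xs" for xs :: "int list" and i y
    using that by (induction xs arbitrary: i) (auto split: nat.split)
  show ?thesis using assms by (simp add: map_update upd)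
qed

theorem theorem4p7:
  fixes n k j j' :: nat and f f' :: "nat \<Rightarrow> nat" and t :: "int list"
  assumes "n > 0"
    and "k \<ge> 2"
    and "weak_maximizer (cycle_verts n) (cycle_adj n) k f"
    and "weak_maximizer (cycle_verts n) (cycle_adj n) k f'"
    and "t = coloring_type (cycle_verts n) k f"
    and "1 \<le> j" and "j < j'" and "j' \<le> k"
    and "coloring_type (cycle_verts n) k f' = reverse_robin_hood j j' t"
  shows "((even n \<and> (\<exists>a::int. a > 0 \<and> t ! (j - 1) = 2 * a \<and> t ! (j' - 1) = 2 * a)) \<longrightarrow>
            wiener_coloring (cycle_verts n) (cycle_adj n) k f
              = wiener_coloring (cycle_verts n) (cycle_adj n) k f') \<and>
         (\<not> (even n \<and> (\<exists>a::int. a > 0 \<and> t ! (j - 1) = 2 * a \<and> t ! (j' - 1) = 2 * a)) \<longrightarrow>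
            wiener_coloring (cycle_verts n) (cycle_adj n) k f
              < wiener_coloring (cycle_verts n) (cycle_adj n) k f')"
proof -
  let ?V = "cycle_verts n" and ?W = "wiener_coloring (cycle_verts n) (cycle_adj n) k"
  have fin: "finite ?V" and cardV: "card ?V = n" by (simp_all add: cycle_verts_def)
  have surj: "surj_coloring ?V k f" "surj_coloring ?V k f'"
    using assms(3,4) by (simp_all add: weak_maximizer_def)
  define p where "p = t ! (j - 1)"
  define q where "q = t ! (j' - 1)"
  have len: "length t = k" using assms(5) by (simp add: coloring_type_length)
  have ix: "j - 1 < length t" "j' - 1 < length t" "j - 1 < j' - 1" using len assms(6-8) by auto
  define t' where "t' = t[j - 1 := p - 1, j' - 1 := q + 1]"
  have type': "coloring_type ?V k f' = sort t'"
    using assms(9) by (simp add: reverse_robin_hood_def t'_def p_def q_def)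
  have pq: "p \<le> q"
    unfolding p_def q_def using ix assms(5) by (intro sorted_nth_mono) (auto simp: coloring_type_def)
  \<comment> \<open>The size \<open>p - 1\<close> occurs in the type of the surjective coloring \<open>f'\<close>, so it is positive.\<close>
  have "p \<ge> 2"
  proof -
    have "t' ! (j - 1) = p - 1" using ix by (simp add: t'_def)
    then have "p - 1 \<in> set (coloring_type ?V k f')"
      using ix by (metis type' set_sort nth_mem t'_def length_list_update)
    then show ?thesis
      using color_class_card_pos[OF surj(2) fin] by (fastforce simp: coloring_type_set)
  qed
  \<comment> \<open>Replacing these two entries by \<open>0\<close> leaves a nonnegative sum.\<close>
  have "p + q \<le> int n"
  proof -
    have "sum_list (map id t) = int n"
      unfolding assms(5) coloring_type_sum using color_class_card_sum[OF surj(1) fin] cardV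
      by (simp flip: of_nat_sum)
    moreover have "sum_list (map id (t[j - 1 := 0, j' - 1 := 0])) = sum_list (map id t) - p - q"
      using ix sum_list_two_updates[of "j - 1" t "j' - 1" id 0 0] by (simp add: p_def q_def)
    moreover have "0 \<le> sum_list (map id (t[j - 1 := 0, j' - 1 := 0]))"
    proof (rule sum_list_nonneg)
      fix x assume "x \<in> set (map id (t[j - 1 := 0, j' - 1 := 0]))"
      then have "x = 0 \<or> x \<in> set t" by (auto dest!: set_update_subset_insert[THEN subsetD])
      then show "0 \<le> x" by (auto simp: assms(5) coloring_type_set)
    qed
    ultimately show ?thesis by simp
  qed
  note D = eightfold_maximum_transfer[OF pq \<open>p \<ge> 2\<close> this]
  have "8 * int (?W f') = sum_list (map (eightfold_maximum n) t')"
    using weak_maximizer_value[OF assms(1,4)]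
    unfolding type' sum_mset_sum_list[symmetric] mset_map mset_sort .
  also have "\<dots> = 8 * int (?W f) - eightfold_maximum n p - eightfold_maximum n q
      + eightfold_maximum n (p - 1) + eightfold_maximum n (q + 1)"
    using ix sum_list_two_updates[of "j - 1" t "j' - 1"] weak_maximizer_value[OF assms(1,3)]
    by (simp add: t'_def p_def q_def assms(5))
  finally have diff: "8 * int (?W f') = \<dots>" .
  have "(\<exists>a::int. a > 0 \<and> p = 2 * a \<and> q = 2 * a) \<longleftrightarrow> p = q \<and> even p"
    using \<open>p \<ge> 2\<close> by (auto elim!: evenE)
  then show ?thesis
    using D diff unfolding p_def[symmetric] q_def[symmetric] by (auto split: if_splits)
qed

end
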